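(* Let $G$ be a biconnected 4-planar graph with positive flexibility, having a valid orthogonal representation. Then $G$ has a valid orthogonal representation with the same planar embedding, the same angles around vertices and at most three bends per edge, except for at most one edge on the outer face with up to five bends.
   Context: A 4-planar graph is a planar graph of maximum degree at most $4$. An orthogonal representation $\mathcal R$ of a biconnected 4-planar graph $G$ consists of a planar embedding of $G$ (with a designated outer face) together with integers $\mathrm{rot}(e_f)$ and $\mathrm{rot}(v_f)\in\{-1,0,1\}$ for every incidence of an edge $e$, respectively a vertex $v$, with a face $f$, such that: (I) if $e$ is incident to the faces $f_1,f_2$, then $\mathrm{rot}(e_{f_1})=-\mathrm{rot}(e_{f_2})$; (II) the sum of all rotations of edges and vertices in a face is $4$ for every inner face and $-4$ for the outer face; (III) the sum of the rotations around every vertex $v$ is $2(\deg(v)-2)$. Meaning: traversing $f$ with $f$ on the right (clockwise for inner faces, counter-clockwise for the outer face), $\mathrm{rot}(e_f)$ is the number of right bends minus the number of left bends of $e$, and $\mathrm{rot}(v_f)=1,0,-1$ for a right turn, no turn, left turn at $v$ (angle $90^\circ,180^\circ,270^\circ$ of $v$ in $f$). The number of bends of $e$ is $|\mathrm{rot}(e_f)|$. Every edge $e$ has a flexibility $\mathrm{flex}(e)\in\mathbb N_0\cup\{\infty\}$. $G$ has positive flexibility if $\mathrm{flex}(e)\ge 1$ for every edge $e$. An orthogonal representation is valid if every edge $e$ has at most $\mathrm{flex}(e)$ bends. "The same planar embedding" (including the outer face) and "the same angles around vertices" (all values $\mathrm{rot}(v_f)$) refer to the given valid orthogonal representation. *)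

theory Defs
  imports "Graph_Theory.Digraph_Component" "HOL-Combinatorics.Orbits" "HOL-Library.Extended_Nat"
begin

text \<open>
  A finite simple graph is a \<open>pair_graph\<close>: every undirected edge \<open>{u, v}\<close> is represented by
  its two darts \<open>(u, v)\<close> and \<open>(v, u)\<close>.
\<close>

type_synonym 'v dart = "'v \<times> 'v"

fun edge_of :: "'v dart \<Rightarrow> 'v set" where
  "edge_of (u, v) = {u, v}"

definition edges :: "'v pair_pre_digraph \<Rightarrow> 'v set set" where
  "edges G = edge_of ` parcs G"

abbreviation darts_at :: "'v pair_pre_digraph \<Rightarrow> 'v \<Rightarrow> 'v dart set" where
  "darts_at G v \<equiv> out_arcs (with_proj G) v"

abbreviation degree :: "'v pair_pre_digraph \<Rightarrow> 'v \<Rightarrow> nat" where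
  "degree G v \<equiv> out_degree (with_proj G) v"

definition biconnected :: "'v pair_pre_digraph \<Rightarrow> bool" where
  "biconnected G \<longleftrightarrow> connected (with_proj G) \<and>
     (\<forall>v \<in> pverts G. connected (pre_digraph.del_vert (with_proj G) v))"

text \<open>
  Planar embeddings are combinatorial: \<open>rotation\<close> maps each dart to the next dart, in
  counter-clockwise order, among the darts with the same tail. The face lying to the right of
  a dart \<open>(u, v)\<close> is then bounded next by the dart following \<open>(v, u)\<close> around \<open>v\<close>. A face is
  identified with the set of darts having it on their right.
\<close>

record 'v embedding =
  rotation :: "'v dart \<Rightarrow> 'v dart"
  outer_face :: "'v dart set"

definition face_succ :: "'v embedding \<Rightarrow> 'v dart \<Rightarrow> 'v dart" where
  "face_succ E d = rotation E (prod.swap d)"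

definition faces :: "'v pair_pre_digraph \<Rightarrow> 'v embedding \<Rightarrow> 'v dart set set" where
  "faces G E = orbit (face_succ E) ` parcs G"

text \<open>
  The last condition says that the embedding has genus 0. Euler's formula takes this form
  because \<open>G\<close> is required to be connected.
\<close>

definition planar_embedding :: "'v pair_pre_digraph \<Rightarrow> 'v embedding \<Rightarrow> bool" where
  "planar_embedding G E \<longleftrightarrow>
     connected (with_proj G) \<and>
     rotation E permutes parcs G \<and>
     (\<forall>v \<in> pverts G. darts_at G v \<noteq> {} \<longrightarrow> cyclic_on (rotation E) (darts_at G v)) \<and>
     outer_face E \<in> faces G E \<and>
     int (card (pverts G)) - int (card (edges G)) + int (card (faces G E)) = 2"

definition four_planar :: "'v pair_pre_digraph \<Rightarrow> bool" where
  "four_planar G \<longleftrightarrow> (\<exists>E. planar_embedding G E) \<and> (\<forall>v \<in> pverts G. degree G v \<le> 4)"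

text \<open>
  Incidences with faces are represented by darts. A dart \<open>d\<close> is the incidence of its edge with
  the face on its right, and \<open>edge_rot R d\<close> is the rotation of the edge in that face; the other
  incidence of the edge is the reversed dart. Likewise, \<open>vert_rot R d\<close> is the rotation of the
  tail of \<open>d\<close> in the face on the right of \<open>d\<close>, at the corner where the boundary of that face
  enters \<open>d\<close>. So the corners at \<open>v\<close> correspond to the darts leaving \<open>v\<close>, and the edge and
  vertex incidences of a face \<open>f\<close> both correspond to the darts in \<open>f\<close>.
\<close>

record 'v orthogonal_rep =
  embedding :: "'v embedding"
  edge_rot :: "'v dart \<Rightarrow> int"
  vert_rot :: "'v dart \<Rightarrow> int"

definition orthogonal_representation ::
    "'v pair_pre_digraph \<Rightarrow> 'v orthogonal_rep \<Rightarrow> bool" where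
  "orthogonal_representation G R \<longleftrightarrow>
     planar_embedding G (embedding R) \<and>
     (\<forall>d \<in> parcs G. vert_rot R d \<in> {-1, 0, 1}) \<and>
     (\<forall>d \<in> parcs G. edge_rot R d = - edge_rot R (prod.swap d)) \<and>
     (\<forall>f \<in> faces G (embedding R).
        (\<Sum>d\<in>f. edge_rot R d) + (\<Sum>d\<in>f. vert_rot R d) =
          (if f = outer_face (embedding R) then -4 else 4)) \<and>
     (\<forall>v \<in> pverts G. (\<Sum>d\<in>darts_at G v. vert_rot R d) = 2 * (int (degree G v) - 2))"

definition bends :: "'v orthogonal_rep \<Rightarrow> 'v dart \<Rightarrow> nat" where
  "bends R d = nat \<bar>edge_rot R d\<bar>"

definition positive_flexibility :: "'v pair_pre_digraph \<Rightarrow> ('v set \<Rightarrow> enat) \<Rightarrow> bool" where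
  "positive_flexibility G flex \<longleftrightarrow> (\<forall>e \<in> edges G. flex e \<ge> 1)"

definition valid_representation ::
    "'v pair_pre_digraph \<Rightarrow> ('v set \<Rightarrow> enat) \<Rightarrow> 'v orthogonal_rep \<Rightarrow> bool" where
  "valid_representation G flex R \<longleftrightarrow>
     orthogonal_representation G R \<and>
     (\<forall>d \<in> parcs G. enat (bends R d) \<le> flex (edge_of d))"

end

theory Submission
  imports Defs
begin

text \<open>
  The rotations of the edges form a flow on the dual graph, so by Hoffman's theorem it suffices to
  check that no bond asks for more rotation than the new bounds allow. Consider a set \<open>S\<close> of
  faces whose boundary is a bond with \<open>n\<close> edges. If \<open>S\<close> omits the outer face, then, as the open
  region \<open>S\<close> has Euler characteristic at most 1, the edges of the bond have total rotation at
  most \<open>4 - \<rho>\<close>, where \<open>\<rho> \<ge> -n\<close> is the rotation at the vertices of the bond, and a vertex contributes \<open>-1\<close> only if just one of its corners lies outside \<open>S\<close>. By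
  biconnectivity this fails for at least two vertices unless the outer face is the only face not in
  \<open>S\<close>. So the rotation is at most \<open>n + 2\<close>, respectively \<open>n + 4\<close>, which one edge of capacity
  3, respectively 5, and further edges of capacity 1 can supply. If \<open>S\<close> contains the outer face, the
  required rotation is smaller by 8. The new bounds are taken relative to the given numbers of bends,
  and the edge of capacity 5 is one with the most bends on the outer face.
\<close>

section \<open>Rooted forests in finite digraphs\<close>

text \<open>The forest grows from its roots in \<open>Q\<close>: the condition for
  \<open>U = N - Q\<close> yields an arc into \<open>Q\<close>, whose tail becomes a new root, and
  so on. Then \<open>p k\<close> leads from \<open>k\<close> to its parent, and the rank
  \<open>r\<close> excludes cycles.\<close>

lemma descending_arcs:
  fixes t h :: "'a \<Rightarrow> 'n"
  assumes "finite (N - Q)"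
    and "\<And>U. \<lbrakk>U \<subseteq> N - Q; U \<noteq> {}\<rbrakk> \<Longrightarrow> \<exists>a\<in>B. t a \<in> U \<and> h a \<in> N - U"
  shows "\<exists>p (r :: 'n \<Rightarrow> nat). \<forall>k\<in>N - Q. p k \<in> B \<and> t (p k) = k \<and> h (p k) \<in> N \<and> r (h (p k)) < r k"
  using assms
proof (induction "card (N - Q)" arbitrary: Q)
  case 0
  then show ?case by auto
next
  case (Suc n)
  then have "N - Q \<noteq> {}" by (metis card.empty nat.distinct(1))
  then obtain a where a: "a \<in> B" "t a \<in> N - Q" "h a \<in> N \<inter> Q"
    using Suc.prems(2)[OF order.refl] by blast
  let ?Q = "insert (t a) Q"
  have "N - ?Q = (N - Q) - {t a}" by auto
  then have "n = card (N - ?Q)" "finite (N - ?Q)"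
    using Suc.hyps(2) Suc.prems(1) a(2) by auto
  then have "\<exists>p (r :: 'n \<Rightarrow> nat). \<forall>k\<in>N - ?Q. p k \<in> B \<and> t (p k) = k \<and> h (p k) \<in> N \<and> r (h (p k)) < r k"
  proof (rule Suc.hyps(1))
    show "\<exists>a\<in>B. t a \<in> U \<and> h a \<in> N - U" if "U \<subseteq> N - ?Q" "U \<noteq> {}" for U
      by (rule Suc.prems(2)) (use that in auto)
  qed
  then obtain p and r :: "'n \<Rightarrow> nat" where
    pr: "\<forall>k\<in>N - ?Q. p k \<in> B \<and> t (p k) = k \<and> h (p k) \<in> N \<and> r (h (p k)) < r k"
    by (elim exE)
  \<comment> \<open>The old roots get rank 0 and all other ranks are raised by 1, so that
    \<open>t a\<close>, whose arc ends in the old \<open>Q\<close>, also lies above its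
    parent.\<close>
  let ?p = "p(t a := a)" and ?r = "\<lambda>k. if k \<in> Q then 0 else Suc (r k)"
  have "?p k \<in> B \<and> t (?p k) = k \<and> h (?p k) \<in> N \<and> ?r (h (?p k)) < ?r k" if "k \<in> N - Q" for k
  proof (cases "k = t a")
    case True
    then show ?thesis using a that by auto
  next
    case False
    then have "k \<in> N - ?Q" using that by simp
    from bspec[OF pr this] show ?thesis using that False by simp
  qed
  then show ?case by (intro exI[of _ ?p] exI[of _ ?r] ballI)
qed

lemma card_filter_insert:
  assumes "finite P" "a \<notin> P"
  shows "card {d \<in> insert a P. Q d} = of_bool (Q a) + card {d \<in> P. Q d}"
proof -
  have "{d \<in> insert a P. Q d} = (if Q a then insert a {d \<in> P. Q d} else {d \<in> P. Q d})"
    by auto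
  then show ?thesis using assms by simp
qed

section \<open>Combinatorial maps, dual cuts and bonds\<close>

text \<open>Vertices and faces are labels of darts. That a class of equal labels is a single orbit
  of \<open>rot\<close>, respectively of the face step \<open>rot (opp d)\<close>, is expressed
  through closed sets of darts, the form in which the proofs apply it.\<close>

locale combinatorial_map =
  fixes A :: "'d set" and opp rot :: "'d \<Rightarrow> 'd"
    and src :: "'d \<Rightarrow> 'n" and face :: "'d \<Rightarrow> 'f"
  assumes finite_darts: "finite A"
    and opp_in: "d \<in> A \<Longrightarrow> opp d \<in> A"
    and opp_opp: "d \<in> A \<Longrightarrow> opp (opp d) = d"
    and rot_in: "d \<in> A \<Longrightarrow> rot d \<in> A"
    and src_rot: "d \<in> A \<Longrightarrow> src (rot d) = src d"
    and face_rot_opp: "d \<in> A \<Longrightarrow> face (rot (opp d)) = face d"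
    and rot_transitive: "\<lbrakk>X \<subseteq> A; d \<in> X; \<And>e. e \<in> X \<Longrightarrow> rot e \<in> X; d' \<in> A; src d' = src d\<rbrakk> \<Longrightarrow> d' \<in> X"
    and face_transitive:
      "\<lbrakk>X \<subseteq> A; d \<in> X; \<And>e. e \<in> X \<Longrightarrow> rot (opp e) \<in> X; d' \<in> A; face d' = face d\<rbrakk> \<Longrightarrow> d' \<in> X"
    and no_loop: "d \<in> A \<Longrightarrow> src (opp d) \<noteq> src d"
    and connected:
      "\<lbrakk>U \<subseteq> src ` A; U \<noteq> {}; \<And>d. \<lbrakk>d \<in> A; src d \<in> U\<rbrakk> \<Longrightarrow> src (opp d) \<in> U\<rbrakk> \<Longrightarrow> U = src ` A"
begin

abbreviation "F \<equiv> face ` A"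

abbreviation "V \<equiv> src ` A"

text \<open>A cut edge is represented once, by its dart with \<open>S\<close> on the right, so that
  the cardinality is the number of cut edges.\<close>

definition boundary :: "'f set \<Rightarrow> 'd set" where
  "boundary S = {d \<in> A. face d \<in> S \<and> face (opp d) \<notin> S}"

definition region :: "'f set \<Rightarrow> 'd set" where
  "region S = {d \<in> A. face d \<in> S}"

definition dual_connected :: "'f set \<Rightarrow> bool" where
  "dual_connected S \<longleftrightarrow>
     (\<forall>T. T \<subseteq> S \<longrightarrow> T \<noteq> {} \<longrightarrow> T \<noteq> S \<longrightarrow> (\<exists>d\<in>A. face d \<in> T \<and> face (opp d) \<in> S - T))"

definition bond :: "'f set \<Rightarrow> bool" where
  "bond S \<longleftrightarrow> S \<subseteq> F \<and> S \<noteq> {} \<and> S \<noteq> F \<and> dual_connected S \<and> dual_connected (F - S)"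

text \<open>These are the flows on the dual graph: \<open>x d\<close> goes from
  \<open>face d\<close> to \<open>face (opp d)\<close>, and \<open>sum x (region {f})\<close> is the
  net outflow of \<open>f\<close>.\<close>

definition skew :: "('d \<Rightarrow> int) \<Rightarrow> bool" where
  "skew x \<longleftrightarrow> (\<forall>d\<in>A. x (opp d) = - x d)"

lemma face_rot: "d \<in> A \<Longrightarrow> face (rot d) = face (opp d)"
  using face_rot_opp[of "opp d"] by (simp add: opp_in opp_opp)

lemma finite_boundary [simp]: "finite (boundary S)"
  and finite_region [simp]: "finite (region S)"
  by (simp_all add: boundary_def region_def finite_darts)

text \<open>The dual graph inherits connectedness: if no edge were cut, \<open>region S\<close>
  would be closed under \<open>opp\<close> and hence, as \<open>rot d\<close> lies in the face of
  \<open>opp d\<close>, under \<open>rot\<close>. Its tails would then be closed under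
  adjacency.\<close>

lemma boundary_nonempty:
  assumes "S \<subseteq> F" "S \<noteq> {}" "S \<noteq> F"
  shows "boundary S \<noteq> {}"
proof
  assume empty: "boundary S = {}"
  have opp: "opp d \<in> region S" if "d \<in> region S" for d
    using that empty by (auto simp: boundary_def region_def opp_in)
  have rot: "rot d \<in> region S" if "d \<in> region S" for d
    using opp[OF that] that by (simp add: region_def face_rot rot_in)
  have closed: "d' \<in> region S" if "d \<in> region S" "d' \<in> A" "src d' = src d" for d d'
    using rot_transitive[of "region S" d d'] rot that by (auto simp: region_def)
  have "region S \<noteq> {}"
    using assms by (auto simp: region_def)
  moreover have "src (opp d) \<in> src ` region S" if "d \<in> A" "src d \<in> src ` region S" for d
    using that closed opp by blast
  ultimately have "src ` region S = V"
    using connected[of "src ` region S"] by (auto simp: region_def)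
  have "A \<subseteq> region S"
  proof
    fix d assume "d \<in> A"
    then obtain e where "e \<in> region S" "src d = src e"
      using \<open>src ` region S = V\<close> by (metis imageE imageI)
    then show "d \<in> region S"
      using closed \<open>d \<in> A\<close> by blast
  qed
  then show False
    using assms by (auto simp: region_def)
qed

text \<open>If \<open>S\<close> or its complement is disconnected, the cut is a disjoint union of
  two smaller nonempty cuts, and one of them has positive weight.\<close>

lemma bond_of_positive_cut:
  fixes w :: "'d \<Rightarrow> int"
  assumes "S \<subseteq> F" "sum w (boundary S) > 0"
  shows "\<exists>S'. bond S' \<and> sum w (boundary S') > 0"
  using assms
proof (induction "card (boundary S)" arbitrary: S rule: less_induct)
  case less
  have ne: "boundary S \<noteq> {}"
    using less.prems(2) by auto
  then have S: "S \<noteq> {}" "S \<noteq> F"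
    using opp_in by (auto simp: boundary_def)
  have split: ?case
    if U: "U1 \<subseteq> F" "U2 \<subseteq> F" "U1 \<noteq> {}" "U2 \<noteq> {}" "U1 \<noteq> F" "U2 \<noteq> F"
      "boundary S = boundary U1 \<union> boundary U2" "boundary U1 \<inter> boundary U2 = {}" for U1 U2
  proof -
    have "card (boundary S) = card (boundary U1) + card (boundary U2)"
      using U(7,8) by (simp add: card_Un_disjoint)
    moreover have "card (boundary U1) > 0" "card (boundary U2) > 0"
      using U boundary_nonempty by (auto simp: card_gt_0_iff)
    moreover have "sum w (boundary U1) > 0 \<or> sum w (boundary U2) > 0"
      using U less.prems(2) sum.union_disjoint[of "boundary U1" "boundary U2" w] by auto
    ultimately show ?thesis
      using less.hyps[of U1] less.hyps[of U2] U by auto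
  qed
  show ?case
  proof (cases "bond S")
    case False
    then have "\<not> dual_connected S \<or> \<not> dual_connected (F - S)"
      using S less.prems(1) by (simp add: bond_def)
    then consider T where "T \<subseteq> S" "T \<noteq> {}" "T \<noteq> S" "\<forall>d\<in>A. face d \<in> T \<longrightarrow> face (opp d) \<notin> S - T"
      | T where "T \<subseteq> F - S" "T \<noteq> {}" "T \<noteq> F - S" "\<forall>d\<in>A. face d \<in> T \<longrightarrow> face (opp d) \<notin> F - S - T"
      unfolding dual_connected_def by meson
    then show ?thesis
    proof cases
      case 1
      have reverse: "\<forall>d\<in>A. face d \<in> S - T \<longrightarrow> face (opp d) \<notin> T"
        using 1(4) opp_in opp_opp by metis
      show ?thesis
      proof (rule split[of T "S - T"])
        show "boundary S = boundary T \<union> boundary (S - T)"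
          using 1(1,4) reverse unfolding boundary_def by blast
      qed (use 1(1-3) less.prems(1) S in \<open>auto simp: boundary_def\<close>)
    next
      case 2
      have reverse: "\<forall>d\<in>A. face d \<in> F - S - T \<longrightarrow> face (opp d) \<notin> T"
        using 2(4) opp_in opp_opp by metis
      have opp_F: "\<forall>d\<in>A. face (opp d) \<in> F"
        using opp_in by blast
      show ?thesis
      \<comment> \<open>These are the complements of the two parts \<open>F - S - T\<close> and
        \<open>T\<close> of the outside; passing to complements keeps the orientation of the cut
        darts.\<close>
      proof (rule split[of "S \<union> T" "F - T"])
        show "boundary S = boundary (S \<union> T) \<union> boundary (F - T)"
        proof
          show "boundary S \<subseteq> boundary (S \<union> T) \<union> boundary (F - T)"
            using 2(1) less.prems(1) unfolding boundary_def by blast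
          show "boundary (S \<union> T) \<union> boundary (F - T) \<subseteq> boundary S"
            using 2(1,4) reverse opp_F unfolding boundary_def by blast
        qed
        show "boundary (S \<union> T) \<inter> boundary (F - T) = {}"
          using opp_F unfolding boundary_def by blast
      qed (use 2(1-3) less.prems(1) S in blast)+
    qed
  qed (use less.prems in blast)
qed

text \<open>Discrete divergence theorem: the two darts of an edge with both sides in
  \<open>S\<close> cancel.\<close>

lemma skew_sum_region:
  assumes "skew x"
  shows "sum x (region S) = sum x (boundary S)"
proof -
  let ?I = "{d \<in> A. face d \<in> S \<and> face (opp d) \<in> S}"
  have "sum x ?I = sum (\<lambda>d. x (opp d)) ?I"
    by (rule sum.reindex_bij_witness[of _ opp opp]) (auto simp: opp_in opp_opp)
  also have "\<dots> = - sum x ?I"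
    using assms by (simp add: skew_def sum_negf)
  finally have "sum x ?I = 0" by simp
  moreover have "region S = boundary S \<union> ?I" "boundary S \<inter> ?I = {}"
    by (auto simp: region_def boundary_def)
  ultimately show ?thesis
    using sum.union_disjoint[of "boundary S" ?I x] finite_darts by simp
qed

lemma sum_region_faces:
  assumes "S \<subseteq> F"
  shows "sum g (region S) = (\<Sum>f\<in>S. sum g (region {f}))"
proof -
  have "(\<Sum>f\<in>S. sum g {d \<in> region S. face d = f}) = sum g (region S)"
    using assms finite_darts by (intro sum.group) (auto simp: region_def intro: finite_subset)
  moreover have "{d \<in> region S. face d = f} = region {f}" if "f \<in> S" for f
    using that by (auto simp: region_def)
  ultimately show ?thesis by simp
qed

section \<open>Flows with capacities on the dual graph\<close>

text \<open>Reachability of \<open>g\<close> from \<open>s\<close> along \<open>B\<close>. A path is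
  recorded only as a set of darts with the balance of a unit flow; as it never leaves
  \<open>g\<close>, it can later be closed to a cycle by a dart that is certainly new.\<close>

lemma face_paths_or_cut:
  assumes "B \<subseteq> A" "s \<in> F" "g \<in> F"
  obtains S where "S \<subseteq> F" "s \<in> S" "g \<notin> S" "\<And>d. d \<in> boundary S \<Longrightarrow> d \<notin> B"
  | P where "P \<subseteq> B" "\<And>d. d \<in> P \<Longrightarrow> face d \<noteq> g"
    "\<And>f. int (card {d \<in> P. face d = f}) - int (card {d \<in> P. face (opp d) = f})
      = of_bool (f = s) - of_bool (f = g)"
proof -
  \<comment> \<open>\<open>\<Union>Z\<close> is the set of faces from which \<open>g\<close> cannot
    be reached. The arcs of a forest on the remaining faces descend to \<open>g\<close>.\<close>
  define Z where "Z = {S. S \<subseteq> F \<and> g \<notin> S \<and> (\<forall>d\<in>B. face d \<in> S \<longrightarrow> face (opp d) \<in> S)}"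
  show ?thesis
  proof (cases "s \<in> \<Union>Z")
    case True
    then obtain S where "S \<in> Z" "s \<in> S" by blast
    then show ?thesis
      using that(1)[of S] by (auto simp: Z_def boundary_def)
  next
    case False
    let ?N = "F - \<Union>Z"
    have "\<exists>a\<in>B. face a \<in> U \<and> face (opp a) \<in> ?N - U" if U: "U \<subseteq> ?N - {g}" "U \<noteq> {}" for U
    proof (rule ccontr)
      assume no: "\<not> ?thesis"
      have "face (opp d) \<in> U \<union> \<Union>Z" if "d \<in> B" "face d \<in> U \<union> \<Union>Z" for d
      proof (cases "face d \<in> \<Union>Z")
        case True
        then show ?thesis using that(1) by (auto simp: Z_def)
      next
        case False
        moreover have "face (opp d) \<in> F"
          using that(1) assms(1) opp_in by blast
        ultimately show ?thesis using that no by auto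
      qed
      then have "U \<union> \<Union>Z \<in> Z"
        using U by (auto simp: Z_def)
      then show False using U by auto
    qed
    then have "\<exists>p (r :: 'f \<Rightarrow> nat). \<forall>k\<in>?N - {g}.
        p k \<in> B \<and> face (p k) = k \<and> face (opp (p k)) \<in> ?N \<and> r (face (opp (p k))) < r k"
      using finite_darts by (intro descending_arcs) auto
    then obtain p and r :: "'f \<Rightarrow> nat" where pr: "\<And>k. k \<in> ?N - {g} \<Longrightarrow>
        p k \<in> B \<and> face (p k) = k \<and> face (opp (p k)) \<in> ?N \<and> r (face (opp (p k))) < r k"
      by blast
    \<comment> \<open>The rank bound on the arcs used is what makes \<open>p k\<close> new when it
      is prepended to the path of its parent.\<close>
    have paths: "\<exists>P \<subseteq> p ` {j \<in> ?N - {g}. r j \<le> r k}. \<forall>f.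
        int (card {d \<in> P. face d = f}) - int (card {d \<in> P. face (opp d) = f})
          = of_bool (f = k) - of_bool (f = g)" if "k \<in> ?N" for k
      using that
    proof (induction "r k" arbitrary: k rule: less_induct)
      case less
      show ?case
      proof (cases "k = g")
        case True
        then show ?thesis by (intro exI[of _ "{}"]) auto
      next
        case False
        then have k: "k \<in> ?N - {g}" using less.prems by auto
        let ?k = "face (opp (p k))"
        obtain P where P: "P \<subseteq> p ` {j \<in> ?N - {g}. r j \<le> r ?k}"
          and bal: "\<And>f. int (card {d \<in> P. face d = f}) - int (card {d \<in> P. face (opp d) = f})
          = of_bool (f = ?k) - of_bool (f = g)"
          using less.hyps[of ?k] pr[OF k] by auto
        have fin: "finite P"
          using P finite_darts by (auto intro: finite_subset)
        have new: "p k \<notin> P"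
        proof
          assume "p k \<in> P"
          then obtain j where "p k = p j" "j \<in> ?N - {g}" "r j \<le> r ?k" using P by auto
          then show False using pr[of j] pr[OF k] by auto
        qed
        have "int (card {d \<in> insert (p k) P. face d = f}) - int (card {d \<in> insert (p k) P. face (opp d) = f})
          = of_bool (f = k) - of_bool (f = g)" for f
          using bal[of f] pr[OF k]
          by (simp add: card_filter_insert[OF fin new] eq_commute[of f] del: insert_iff)
        moreover have "insert (p k) P \<subseteq> p ` {j \<in> ?N - {g}. r j \<le> r k}"
        proof -
          have "{j \<in> ?N - {g}. r j \<le> r ?k} \<subseteq> {j \<in> ?N - {g}. r j \<le> r k}"
            using pr[OF k] by auto
          then show ?thesis using P k by blast
        qed
        ultimately show ?thesis by blast
      qed
    qed
    have "s \<in> ?N" using False assms(2) by blast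
    from paths[OF this] obtain P where P: "P \<subseteq> p ` {j \<in> ?N - {g}. r j \<le> r s}"
      "\<And>f. int (card {d \<in> P. face d = f}) - int (card {d \<in> P. face (opp d) = f})
        = of_bool (f = s) - of_bool (f = g)"
      by (elim exE conjE) blast
    have arcs: "d \<in> B \<and> face d \<noteq> g" if "d \<in> P" for d
    proof -
      obtain j where "d = p j" "j \<in> ?N - {g}" using P(1) \<open>d \<in> P\<close> by blast
      then show ?thesis using pr[of j] by simp
    qed
    show ?thesis
    proof (rule that(2)[of P])
      show "P \<subseteq> B" using arcs by blast
    qed (simp_all add: arcs P(2))
  qed
qed

text \<open>Hoffman's circulation theorem on the dual graph.\<close>

lemma skew_with_capacities:
  fixes x c :: "'d \<Rightarrow> int"
  assumes c: "\<And>d. d \<in> A \<Longrightarrow> c (opp d) = c d" "\<And>d. d \<in> A \<Longrightarrow> c d \<ge> 0"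
    and "skew x"
    and "\<And>S. bond S \<Longrightarrow> sum x (region S) \<le> sum c (boundary S)"
  shows "\<exists>y. skew y \<and> (\<forall>f\<in>F. sum y (region {f}) = sum x (region {f})) \<and> (\<forall>d\<in>A. \<bar>y d\<bar> \<le> c d)"
  using assms(3,4)
proof (induction "\<Sum>d\<in>A. nat (\<bar>x d\<bar> - c d)" arbitrary: x rule: less_induct)
  case less
  note skew = less.prems(1)
  show ?case
  proof (cases "\<forall>d\<in>A. \<bar>x d\<bar> \<le> c d")
    case True
    then show ?thesis using skew by blast
  next
    case False
    then obtain d1 where d1: "d1 \<in> A" "\<bar>x d1\<bar> > c d1" by auto
    obtain d0 where d0: "d0 \<in> A" "x d0 > c d0"
    proof (cases "x d1 \<ge> 0")
      case True
      then show ?thesis using d1 that by auto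
    next
      case False
      then show ?thesis using d1 skew c opp_in that[of "opp d1"] by (auto simp: skew_def)
    qed
    \<comment> \<open>The residual arcs, along which one more unit can be sent.\<close>
    let ?B = "{d \<in> A. x d < c d}"
    have "face d0 \<in> F" "face (opp d0) \<in> F" "?B \<subseteq> A"
      using d0 opp_in by auto
    from face_paths_or_cut[OF this(3,1,2)] show ?thesis
    proof cases
      case (1 S)
      \<comment> \<open>No residual arc leaves \<open>S\<close>, so its boundary is saturated and
        \<open>d0\<close> even exceeds its capacity. This cut violates the condition, hence some
        bond does.\<close>
      have "x d \<ge> c d" if "d \<in> boundary S" for d
        using 1(4)[OF that] that by (auto simp: boundary_def)
      moreover have "d0 \<in> boundary S"
        using 1 d0 by (auto simp: boundary_def)
      ultimately have "sum c (boundary S) < sum x (boundary S)"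
        using d0 by (intro sum_strict_mono_ex1) auto
      then have "sum (\<lambda>d. x d - c d) (boundary S) > 0"
        by (simp add: sum_subtractf)
      then obtain S' where "bond S'" "sum (\<lambda>d. x d - c d) (boundary S') > 0"
        using bond_of_positive_cut 1(1) by blast
      then show ?thesis
        using less.prems(2)[of S'] skew_sum_region[OF skew, of S'] by (simp add: sum_subtractf)
    next
      case (2 P0)
      define P where "P = insert (opp d0) P0"
      \<comment> \<open>One unit is pushed round the cycle that consists of the path
        \<open>P0\<close> from \<open>face d0\<close> to \<open>face (opp d0)\<close> and the dart
        \<open>opp d0\<close>. This lowers the flow on \<open>d0\<close> by 1 and preserves all net
        outflows.\<close>
      define y where "y d = x d + of_bool (d \<in> P) - of_bool (opp d \<in> P)" for d
      have "x (opp d0) < c (opp d0)"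
        using skew d0 c[of d0] by (simp add: skew_def)
      then have P: "P \<subseteq> A" "\<And>d. d \<in> P \<Longrightarrow> x d < c d"
        using 2(1) d0 opp_in by (auto simp: P_def)
      have finP: "finite P"
        using P finite_darts finite_subset by blast
      have new: "opp d0 \<notin> P0" using 2(2) by auto
      have "d0 \<notin> P"
        using P(2)[of d0] d0 by auto
      have "skew y"
        using skew by (auto simp: skew_def y_def opp_opp)
      \<comment> \<open>By integrality, a dart raised from below its capacity does not exceed
        it.\<close>
      have le: "nat (\<bar>y d\<bar> - c d) \<le> nat (\<bar>x d\<bar> - c d)" if "d \<in> A" for d
      proof -
        have "- x d < c d" if "opp d \<in> P"
          using P(2)[OF that] \<open>d \<in> A\<close> skew c(1) by (simp add: skew_def)
        then show ?thesis
          using P(2)[of d] by (auto simp: y_def)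
      qed
      have less': "nat (\<bar>y d0\<bar> - c d0) < nat (\<bar>x d0\<bar> - c d0)"
        using \<open>d0 \<notin> P\<close> d0 c(2)[of d0] by (auto simp: y_def P_def)
      have dec: "(\<Sum>d\<in>A. nat (\<bar>y d\<bar> - c d)) < (\<Sum>d\<in>A. nat (\<bar>x d\<bar> - c d))"
        using le less' d0 finite_darts by (intro sum_strict_mono_ex1) auto
      have faces: "sum y (region {f}) = sum x (region {f})" for f
      proof -
        have sum1: "(\<Sum>d\<in>region {f}. of_bool (d \<in> P) :: int) = int (card {d \<in> P. face d = f})"
        proof -
          have "region {f} \<inter> {d. d \<in> P} = {d \<in> P. face d = f}"
            using P(1) by (auto simp: region_def)
          then show ?thesis by (simp add: sum_of_bool_eq)
        qed
        have sum2: "(\<Sum>d\<in>region {f}. of_bool (opp d \<in> P) :: int) = int (card {d \<in> P. face (opp d) = f})"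
        proof -
          have "bij_betw opp (region {f} \<inter> {d. opp d \<in> P}) {d \<in> P. face (opp d) = f}"
            using P(1) opp_in by (intro bij_betw_byWitness[of _ opp]) (auto simp: region_def opp_opp)
          then show ?thesis using bij_betw_same_card by (simp add: sum_of_bool_eq) 
        qed
        have "int (card {d \<in> P. face d = f}) = int (card {d \<in> P. face (opp d) = f})"
          using 2(3)[of f] new finP d0(1) unfolding P_def
          by (simp add: card_filter_insert opp_opp eq_commute[of f] del: insert_iff)
        then show ?thesis
          using sum1 sum2 by (simp add: y_def sum.distrib sum_subtractf)
      qed
      have "sum y (region S) \<le> sum c (boundary S)" if "bond S" for S
      proof -
        have "S \<subseteq> F" using that by (simp add: bond_def)
        then show ?thesis
          using less.prems(2)[OF that] by (simp add: sum_region_faces faces)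
      qed
      from less.hyps[OF dec \<open>skew y\<close> this] show ?thesis
        using faces by metis
    qed
  qed
qed

section \<open>Euler characteristic of a set of faces\<close>

text \<open>The closed walk round the face leaves \<open>U\<close> along \<open>d\<close> and has to
  return. Otherwise its darts with tail outside \<open>U\<close>, among them the successor of
  \<open>d\<close>, would be closed under the face step and contain \<open>d\<close> itself.\<close>

lemma face_crosses_back:
  assumes "d \<in> A" "src d \<in> U" "src (opp d) \<notin> U"
  shows "\<exists>e\<in>A. face e = face d \<and> src e \<notin> U \<and> src (opp e) \<in> U"
proof (rule ccontr)
  assume no: "\<not> ?thesis"
  define X where "X = {e \<in> A. face e = face d \<and> src e \<notin> U}"
  have next_X: "rot (opp e) \<in> X" if "e \<in> A" "face e = face d" "src (opp e) \<notin> U" for e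
    using that by (simp add: X_def opp_in rot_in face_rot_opp src_rot)
  have "d \<in> X"
  proof (rule face_transitive[of X "rot (opp d)"])
    show "rot (opp e) \<in> X" if "e \<in> X" for e
      using that no next_X[of e] by (auto simp: X_def)
  qed (use assms next_X[of d] face_rot_opp in \<open>auto simp: X_def\<close>)
  then show False using assms by (simp add: X_def)
qed

lemma inj_on_opp: "inj_on opp A"
  by (metis inj_onI opp_opp)

lemma card_union_opp:
  assumes "X \<subseteq> A" "X \<inter> opp ` X = {}"
  shows "card (X \<union> opp ` X) = 2 * card X"
proof -
  have "finite X" using assms(1) finite_darts finite_subset by blast
  moreover have "card (opp ` X) = card X"
    using assms(1) inj_on_opp card_image inj_on_subset by blast
  ultimately show ?thesis
    using assms(2) by (simp add: card_Un_disjoint)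
qed

definition interior :: "'f set \<Rightarrow> 'n set" where
  "interior S = {v \<in> V. \<forall>d\<in>A. src d = v \<longrightarrow> face d \<in> S}"

text \<open>
  The open region formed by the faces of \<open>S\<close>, the edges between them and the interior vertices is
  connected and not closed, so its Euler characteristic is at most 1. For the proof, cut a spanning
  tree of the dual graph out of \<open>G\<close>: a set of interior vertices whose whole coboundary lies in the
  tree would meet the deepest face of that coboundary in one edge only, whereas every face crosses
  it in both directions. Hence the other edges still join all interior vertices to the outside.
\<close>

lemma interior_euler:
  assumes S: "S \<subseteq> F" "S \<noteq> {}" "S \<noteq> F" "dual_connected S"
  shows "2 * card S + 2 * card (interior S) \<le> card (region S - boundary S) + 2"
proof -
  let ?W = "interior S"
  obtain s where s: "s \<in> S" using S by auto
  have fin: "finite S" "finite ?W"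
    using S finite_darts by (auto simp: interior_def intro: finite_subset)
  have "\<exists>d\<in>A. face d \<in> U \<and> face (opp d) \<in> S - U" if "U \<subseteq> S - {s}" "U \<noteq> {}" for U
  proof -
    have "U \<subseteq> S" "U \<noteq> S" using that s by auto
    then show ?thesis using S(4) that(2) by (simp add: dual_connected_def)
  qed
  then have "\<exists>p (r :: 'f \<Rightarrow> nat). \<forall>k\<in>S - {s}.
      p k \<in> A \<and> face (p k) = k \<and> face (opp (p k)) \<in> S \<and> r (face (opp (p k))) < r k"
    using fin by (intro descending_arcs) auto
  then obtain p and r :: "'f \<Rightarrow> nat" where p: "\<And>k. k \<in> S - {s} \<Longrightarrow>
      p k \<in> A \<and> face (p k) = k \<and> face (opp (p k)) \<in> S \<and> r (face (opp (p k))) < r k"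
    by blast
  let ?P = "p ` (S - {s})"
  \<comment> \<open>Both darts of each edge of a spanning tree of the dual graph on
    \<open>S\<close>, with root \<open>s\<close>.\<close>
  define T where "T = ?P \<union> opp ` ?P"
  have T_opp: "d \<in> T" if "opp d \<in> T" "d \<in> A" for d
  proof -
    from \<open>opp d \<in> T\<close> consider k where "k \<in> S - {s}" "opp d = p k"
      | k where "k \<in> S - {s}" "opp d = opp (p k)"
      unfolding T_def by blast
    then show ?thesis
    proof cases
      case (1 k)
      then have "d = opp (p k)" using opp_opp[OF \<open>d \<in> A\<close>] by simp
      then show ?thesis using 1(1) by (simp add: T_def)
    next
      case (2 k)
      have "p k \<in> A" using p[OF 2(1)] by (rule conjunct1)
      then have "d = p k" using inj_onD[OF inj_on_opp 2(2) \<open>d \<in> A\<close>] by simp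
      then show ?thesis using 2(1) by (simp add: T_def)
    qed
  qed
  have "\<exists>d\<in>A - T. src d \<in> U \<and> src (opp d) \<in> V - U" if U: "U \<subseteq> V - (V - ?W)" "U \<noteq> {}" for U
  proof (rule ccontr)
    assume no: "\<not> ?thesis"
    define C where "C = {d \<in> A. (src d \<in> U) \<noteq> (src (opp d) \<in> U)}"
    have C_opp: "opp d \<in> C" if "d \<in> C" for d
      using that by (auto simp: C_def opp_in opp_opp)
    have out: "d \<in> T" if "d \<in> A" "src d \<in> U" "src (opp d) \<notin> U" for d
      using that no opp_in by auto
    have C_T: "C \<subseteq> T"
    proof
      fix d assume d: "d \<in> C"
      show "d \<in> T"
      proof (cases "src d \<in> U")
        case True
        then show ?thesis using d out by (auto simp: C_def)
      next
        case False
        then have "opp d \<in> T"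
          using d out[of "opp d"] by (auto simp: C_def opp_in opp_opp)
        then show ?thesis using d T_opp by (auto simp: C_def)
      qed
    qed
    have "C \<noteq> {}"
    proof
      assume "C = {}"
      then have "U = V"
        using U by (intro connected) (auto simp: C_def)
      moreover obtain d where "d \<in> A" "face d \<notin> S"
        using S by auto
      ultimately show False
        using U by (auto simp: interior_def)
    qed
    define K where "K = {k \<in> S - {s}. p k \<in> C}"
    have tree: "(\<exists>k\<in>K. d = p k) \<or> (\<exists>k\<in>K. d = opp (p k))" if "d \<in> C" for d
    proof -
      have "d \<in> ?P \<or> d \<in> opp ` ?P"
        using that C_T by (auto simp: T_def)
      then show ?thesis
      proof
        assume "d \<in> opp ` ?P"
        then obtain k where k: "k \<in> S - {s}" "d = opp (p k)" by auto
        then have "p k \<in> C" using C_opp[OF that] p opp_opp by simp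
        then show ?thesis using k by (auto simp: K_def)
      qed (use that in \<open>auto simp: K_def\<close>)
    qed
    have "K \<noteq> {}" using \<open>C \<noteq> {}\<close> tree by blast
    moreover have "finite K" using fin by (simp add: K_def)
    ultimately have "Max (r ` K) \<in> r ` K" by simp
    then obtain f where f: "f \<in> K" "Max (r ` K) = r f" by auto
    have deepest: "r k \<le> r f" if "k \<in> K" for k
      using that \<open>finite K\<close> f(2) by (metis Max_ge finite_imageI imageI)
    have pf: "p f \<in> A" "face (p f) = f" "p f \<in> C"
      using f p by (auto simp: K_def)
    obtain e where e: "e \<in> C" "face e = f" "e \<noteq> p f"
    proof (cases "src (p f) \<in> U")
      case True
      then obtain e where "e \<in> A" "face e = f" "src e \<notin> U" "src (opp e) \<in> U"
        using face_crosses_back[of "p f" U] pf by (auto simp: C_def)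
      then show ?thesis using True by (intro that[of e]) (auto simp: C_def)
    next
      case False
      then obtain e where "e \<in> A" "face e = f" "src e \<in> U" "src (opp e) \<notin> U"
        using face_crosses_back[of "p f" "- U"] pf by (auto simp: C_def)
      then show ?thesis using False by (intro that[of e]) (auto simp: C_def)
    qed
    \<comment> \<open>A second tree dart of \<open>f\<close> in the coboundary cannot be a parent
      arc, as \<open>p f\<close> is the only one starting in \<open>f\<close>; so it reverses the
      parent arc of a child of \<open>f\<close>, which is deeper than \<open>f\<close>.\<close>
    from tree[OF e(1)] show False
    proof (elim disjE bexE)
      fix k assume "k \<in> K" "e = p k"
      then show False using e p by (auto simp: K_def)
    next
      fix k assume k: "k \<in> K" "e = opp (p k)"
      then have "r f < r k" using e p by (auto simp: K_def)
      then show False using deepest[OF k(1)] by simp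
    qed
  qed
  then have tree_W: "\<exists>q (m :: 'n \<Rightarrow> nat). \<forall>v\<in>V - (V - ?W).
      q v \<in> A - T \<and> src (q v) = v \<and> src (opp (q v)) \<in> V \<and> m (src (opp (q v))) < m v"
    using finite_darts by (intro descending_arcs) auto
  have "V - (V - ?W) = ?W" by (auto simp: interior_def)
  from tree_W[unfolded this] obtain q and m :: "'n \<Rightarrow> nat" where q: "\<And>v. v \<in> ?W \<Longrightarrow>
      q v \<in> A - T \<and> src (q v) = v \<and> src (opp (q v)) \<in> V \<and> m (src (opp (q v))) < m v"
    by blast
  let ?Q = "q ` ?W"
  \<comment> \<open>The rank drops along both arcs, so they cannot be reverse to each other. Hence
    every tree edge gives exactly two darts.\<close>
  have "p k \<noteq> opp (p j)" if "k \<in> S - {s}" "j \<in> S - {s}" for j k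
  proof
    assume "p k = opp (p j)"
    then show False
      using p[OF that(1)] p[OF that(2)] opp_opp[of "p j"] by auto
  qed
  then have cardT: "card T = 2 * card ?P"
    unfolding T_def using p by (intro card_union_opp) auto
  have "q v \<noteq> opp (q w)" if "v \<in> ?W" "w \<in> ?W" for v w
  proof
    assume "q v = opp (q w)"
    then show False
      using q[OF that(1)] q[OF that(2)] opp_opp[of "q w"] by auto
  qed
  then have cardQ: "card (?Q \<union> opp ` ?Q) = 2 * card ?W"
  proof -
    assume *: "\<And>v w. \<lbrakk>v \<in> ?W; w \<in> ?W\<rbrakk> \<Longrightarrow> q v \<noteq> opp (q w)"
    have "card (?Q \<union> opp ` ?Q) = 2 * card ?Q"
      using q * by (intro card_union_opp) auto
    moreover have "card ?Q = card ?W"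
      using q by (intro card_image inj_onI) metis
    ultimately show ?thesis by simp
  qed
  have "card ?P = card (S - {s})"
    using p by (intro card_image inj_onI) metis
  then have cardP: "card ?P + 1 = card S"
    using s fin by (simp add: card_gt_0_iff) (metis Suc_pred card_gt_0_iff empty_iff)
  have "T \<subseteq> region S - boundary S"
    using p opp_in opp_opp by (auto simp: T_def region_def boundary_def)
  moreover have "?Q \<union> opp ` ?Q \<subseteq> region S - boundary S"
  proof -
    \<comment> \<open>Both sides of \<open>q v\<close> are faces at the interior vertex
      \<open>v\<close>, since the face of \<open>opp (q v)\<close> has its corner at
      \<open>rot (q v)\<close>.\<close>
    have "face (q v) \<in> S \<and> face (opp (q v)) \<in> S" if "v \<in> ?W" for v
    proof -
      have "rot (q v) \<in> A" "src (rot (q v)) = v" "face (rot (q v)) = face (opp (q v))"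
        using q[OF that] rot_in src_rot face_rot by auto
      then show ?thesis
        using q[OF that] that unfolding interior_def by force
    qed
    then show ?thesis
      using q opp_in opp_opp by (auto simp: region_def boundary_def)
  qed
  \<comment> \<open>The \<open>card S - 1\<close> tree edges and the \<open>card ?W\<close> forest
    edges are thus distinct edges inside the region, each counted by two darts.\<close>
  moreover have "T \<inter> (?Q \<union> opp ` ?Q) = {}"
    using q T_opp by blast
  moreover have "finite T" "finite (?Q \<union> opp ` ?Q)"
    using fin by (auto simp: T_def)
  ultimately have "card T + card (?Q \<union> opp ` ?Q) \<le> card (region S - boundary S)"
    by (metis Un_least card_Un_disjoint card_mono finite_Diff finite_region)
  then show ?thesis
    using cardT cardQ cardP by linarith
qed

end

section \<open>Rotation required across a bond of a biconnected map\<close>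

locale biconnected_map = combinatorial_map A opp rot src face
  for A :: "'d set" and opp rot :: "'d \<Rightarrow> 'd"
    and src :: "'d \<Rightarrow> 'n" and face :: "'d \<Rightarrow> 'f" +
  assumes biconnected:
    "\<lbrakk>v \<in> V; U \<subseteq> V - {v}; U \<noteq> {}; \<And>d. \<lbrakk>d \<in> A; src d \<in> U; src (opp d) \<noteq> v\<rbrakk> \<Longrightarrow> src (opp d) \<in> U\<rbrakk>
      \<Longrightarrow> U = V - {v}"
begin

text \<open>An edge with both sides outside \<open>S\<close> would have an end other than
  \<open>v\<close> with two outside corners, hence no corner in \<open>S\<close>. Such vertices are
  closed under adjacency in the graph without \<open>v\<close>, so by biconnectivity they would be
  all of \<open>V - {v}\<close>; but both ends of a cut edge touch \<open>S\<close>. So no dual edge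
  joins two outside faces, and the connected outside is one face.\<close>

lemma single_face_if_simple_boundary:
  assumes S: "S \<subseteq> F" "S \<noteq> {}" "S \<noteq> F" "dual_connected (F - S)" and "v \<in> V"
    and simple: "\<And>d e c. \<lbrakk>d \<in> A; e \<in> A; c \<in> A; src d = src c; src e = src c; src c \<noteq> v;
      face c \<in> S; face d \<notin> S; face e \<notin> S\<rbrakk> \<Longrightarrow> d = e"
  shows "\<exists>g. F - S = {g}"
proof -
  define B where "B = {w \<in> V - {v}. \<forall>d\<in>A. src d = w \<longrightarrow> face d \<notin> S}"
  have B: "src d \<in> B" if d: "d \<in> A" "face d \<notin> S" "face (opp d) \<notin> S" "src d \<noteq> v" for d
  proof (rule ccontr)
    assume "src d \<notin> B"
    then obtain c where c: "c \<in> A" "src c = src d" "face c \<in> S"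
      using d(1,4) unfolding B_def by blast
    \<comment> \<open>The corners at \<open>d\<close> and \<open>rot d\<close> both lie outside
      \<open>S\<close>, so they coincide. Then \<open>d\<close> is the only dart at its tail, which
      contradicts \<open>c\<close>.\<close>
    have "rot d = d"
    proof (rule simple[of "rot d" d c])
      show "src (rot d) = src c" "face (rot d) \<notin> S"
        using d c(2) by (simp_all add: src_rot face_rot)
    qed (use c d rot_in in simp_all)
    then have "c \<in> {d}"
      using c d by (intro rot_transitive[of "{d}" d c]) auto
    then show False using c d by simp
  qed
  obtain b where b: "b \<in> A" "face b \<in> S" "face (opp b) \<notin> S"
    using boundary_nonempty[OF S(1-3)] by (auto simp: boundary_def)
  have no_inner: "False" if d: "d \<in> A" "face d \<notin> S" "face (opp d) \<notin> S" for d
  proof -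
    have "src d \<in> B \<or> src (opp d) \<in> B"
      using B[of d] B[of "opp d"] d no_loop[of d] by (auto simp: opp_in opp_opp)
    then have "B \<noteq> {}" by auto
    have closed: "src (opp c) \<in> B" if c: "c \<in> A" "src c \<in> B" "src (opp c) \<noteq> v" for c
    proof -
      have "rot c \<in> A" "src (rot c) = src c"
        using c(1) by (simp_all add: rot_in src_rot)
      then have "face c \<notin> S" "face (rot c) \<notin> S"
        using c(1,2) unfolding B_def by simp_all
      then show ?thesis
        using c(1,3) B[of "opp c"] by (simp add: face_rot opp_in opp_opp)
    qed
    have BV: "B = V - {v}"
    proof (rule biconnected[OF \<open>v \<in> V\<close> _ \<open>B \<noteq> {}\<close> closed])
      show "B \<subseteq> V - {v}" unfolding B_def by blast
    qed
    have "src b \<notin> B"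
      using b(1,2) unfolding B_def by blast
    moreover have "src (opp b) \<notin> B"
    proof -
      have "rot (opp b) \<in> A" "src (rot (opp b)) = src (opp b)" "face (rot (opp b)) \<in> S"
        using b(1,2) by (simp_all add: rot_in opp_in src_rot face_rot_opp)
      then show ?thesis unfolding B_def by blast
    qed
    ultimately show False
      using BV b no_loop[of b] opp_in by auto
  qed
  have "face (opp b) \<in> F - S" using b opp_in by auto
  moreover have "{face (opp b)} = F - S"
  proof (rule ccontr)
    assume "{face (opp b)} \<noteq> F - S"
    then obtain d where "d \<in> A" "face d \<in> {face (opp b)}" "face (opp d) \<in> F - S - {face (opp b)}"
      using S(4)[unfolded dual_connected_def, rule_format, of "{face (opp b)}"] calculation by auto
    then show False using no_inner[of d] b by auto
  qed
  ultimately show ?thesis by metis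
qed

text \<open>
  With \<open>a d\<close> the angle, in units of \<open>90\<close> degrees, at the tail of \<open>d\<close>, the left-hand side is the
  rotation that the edges of the bond must supply if no face of \<open>S\<close> is the outer one.
\<close>

lemma bond_rotation_le:
  fixes a :: "'d \<Rightarrow> int"
  assumes "bond S" and a: "\<And>d. d \<in> A \<Longrightarrow> a d \<ge> 1"
    and angles: "\<And>v. v \<in> V \<Longrightarrow> (\<Sum>d | d \<in> A \<and> src d = v. a d) = 4"
  defines "t \<equiv> 4 * int (card S) + sum a (region S) - 2 * int (card (region S))"
  shows "t \<le> int (card (boundary S)) + 4"
    and "(\<nexists>g. F - S = {g}) \<Longrightarrow> t \<le> int (card (boundary S)) + 2"
proof -
  let ?W = "interior S"
  have S: "S \<subseteq> F" "S \<noteq> {}" "S \<noteq> F" "dual_connected S" "dual_connected (F - S)"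
    using assms(1) by (auto simp: bond_def)
  define in_sum where "in_sum v = sum a {d \<in> region S. src d = v}" for v
  define cuts where "cuts v = card {d \<in> boundary S. src d = v}" for v
  define out where "out v = {d \<in> A. src d = v \<and> face d \<notin> S}" for v
  \<comment> \<open>The bond vertices with at least two outside corners; each of them lowers the
    bound by 1.\<close>
  define bad where "bad = {v \<in> V. (\<exists>c\<in>A. src c = v \<and> face c \<in> S) \<and> card (out v) \<ge> 2}"
  have finV: "finite V" using finite_darts by simp
  have fin_out: "finite (out v)" for v using finite_darts by (simp add: out_def)
  have total: "in_sum v + sum a (out v) = 4" if "v \<in> V" for v
  proof -
    have "{d. d \<in> A \<and> src d = v} = {d \<in> region S. src d = v} \<union> out v"
      by (auto simp: out_def region_def)
    moreover have "{d \<in> region S. src d = v} \<inter> out v = {}"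
      by (auto simp: out_def region_def)
    ultimately show ?thesis
      using angles[OF that] sum.union_disjoint[of "{d \<in> region S. src d = v}" "out v" a] fin_out
      by (simp add: in_sum_def)
  qed
  have out_ge: "sum a (out v) \<ge> int (card (out v))" for v
  proof -
    have "(\<Sum>d\<in>out v. 1) \<le> sum a (out v)"
      using a by (intro sum_mono) (auto simp: out_def)
    then show ?thesis by simp
  qed
  have le4: "in_sum v - 3 * int (cuts v) \<le> 4" if "v \<in> V" for v
    using total[OF that] out_ge[of v] by simp
  \<comment> \<open>At a bond vertex there is a cut dart and an outside corner of angle at least 1,
    so \<open>in_sum v\<close> is at most 3, and at most 2 if \<open>v\<close> is in
    \<open>bad\<close>. A vertex away from \<open>S\<close> contributes nothing.\<close>
  have le: "in_sum v - 3 * int (cuts v) \<le> - of_bool (v \<in> bad)" if v: "v \<in> V - ?W" for v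
  proof (cases "\<exists>c\<in>A. src c = v \<and> face c \<in> S")
    case False
    then have "in_sum v = 0"
      unfolding in_sum_def region_def by (intro sum.neutral) auto
    then show ?thesis using False by (auto simp: bad_def)
  next
    case True
    then obtain c where c: "c \<in> A" "src c = v" "face c \<in> S" by auto
    obtain d where d: "d \<in> out v"
      using v by (auto simp: interior_def out_def)
    \<comment> \<open>Without a cut dart at \<open>v\<close>, turning by \<open>rot\<close> from the
      corner \<open>c\<close> would never leave \<open>S\<close>.\<close>
    have "{d \<in> boundary S. src d = v} \<noteq> {}"
    proof
      assume none: "{d \<in> boundary S. src d = v} = {}"
      have "rot e \<in> {e \<in> region S. src e = v}" if "e \<in> {e \<in> region S. src e = v}" for e
        using that none by (auto simp: region_def boundary_def rot_in src_rot face_rot)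
      then have "d \<in> {e \<in> region S. src e = v}"
        using c d by (intro rot_transitive[of "{e \<in> region S. src e = v}" c d]) (simp_all add: region_def out_def subset_eq)
      then show False using d by (simp add: out_def region_def)
    qed
    then have "cuts v \<ge> 1"
      by (simp add: cuts_def Suc_le_eq card_gt_0_iff)
    moreover have "card (out v) \<ge> 1"
      using d fin_out by (auto simp: Suc_le_eq card_gt_0_iff)
    moreover have "v \<in> bad \<Longrightarrow> card (out v) \<ge> 2"
      by (simp add: bad_def)
    ultimately show ?thesis
      using total[of v] out_ge[of v] v by (cases "v \<in> bad") auto
  qed
  have "sum a (region S) = (\<Sum>v\<in>V. in_sum v)"
    unfolding in_sum_def using finV by (intro sum.group[symmetric]) (auto simp: region_def finite_darts)
  moreover have "card (boundary S) = (\<Sum>v\<in>V. cuts v)"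
  proof -
    have "(\<Sum>v\<in>V. \<Sum>d\<in>{d \<in> boundary S. src d = v}. 1) = (\<Sum>d\<in>boundary S. 1 :: nat)"
      using finV by (intro sum.group) (auto simp: boundary_def finite_darts)
    then show ?thesis by (simp add: cuts_def)
  qed
  ultimately have "sum a (region S) - 3 * int (card (boundary S)) = (\<Sum>v\<in>V. in_sum v - 3 * int (cuts v))"
    by (simp add: sum_subtractf sum_distrib_left)
  also have "\<dots> = (\<Sum>v\<in>V - ?W. in_sum v - 3 * int (cuts v)) + (\<Sum>v\<in>?W. in_sum v - 3 * int (cuts v))"
    using finV by (intro sum.subset_diff) (auto simp: interior_def)
  also have "\<dots> \<le> (\<Sum>v\<in>V - ?W. - of_bool (v \<in> bad)) + (\<Sum>v\<in>?W. 4)"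
    using le le4 by (intro add_mono sum_mono) (auto simp: interior_def)
  also have "(\<Sum>v\<in>V - ?W. - of_bool (v \<in> bad) :: int) = - int (card bad)"
  proof -
    have "v \<notin> ?W" if "v \<in> bad" for v
    proof
      assume "v \<in> ?W"
      then have "out v = {}" by (auto simp: interior_def out_def)
      then show False using that by (simp add: bad_def)
    qed
    then have "(V - ?W) \<inter> {v. v \<in> bad} = bad" by (auto simp: bad_def)
    then show ?thesis using finV by (simp add: sum_negf sum_of_bool_eq)
  qed
  finally have "sum a (region S) \<le> 3 * int (card (boundary S)) - int (card bad) + 4 * int (card ?W)"
    by simp
  moreover have "card (region S) = card (region S - boundary S) + card (boundary S)"
  proof -
    have sub: "boundary S \<subseteq> region S" by (auto simp: boundary_def region_def)
    show ?thesis
      using card_Diff_subset[OF finite_boundary sub] card_mono[OF finite_region sub] by simp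
  qed
  \<comment> \<open>Of the three units per cut dart, two cancel against its share of
    \<open>2 * card (region S)\<close>. Twice the bound of \<open>interior_euler\<close> leaves the
    constant 4.\<close>
  ultimately have t: "t \<le> int (card (boundary S)) + 4 - int (card bad)"
    using interior_euler[OF S(1-4)] by (simp add: t_def)
  then show "t \<le> int (card (boundary S)) + 4" by simp
  assume many: "\<nexists>g. F - S = {g}"
  \<comment> \<open>With at most one vertex in \<open>bad\<close>, that vertex (or any vertex, if
    there is none) serves as the exception \<open>v\<close> in
    \<open>single_face_if_simple_boundary\<close>.\<close>
  have "card bad \<ge> 2"
  proof (rule ccontr)
    assume "\<not> card bad \<ge> 2"
    moreover have "finite bad" using finV by (simp add: bad_def)
    ultimately have single: "\<forall>v\<in>bad. \<forall>w\<in>bad. v = w"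
      by (intro card_le_Suc0_iff_eq[THEN iffD1]) simp_all
    obtain v where v: "v \<in> V" "bad \<subseteq> {v}"
    proof (cases "bad = {}")
      case True
      then show ?thesis using S(1,2) that by blast
    next
      case False
      moreover have "bad \<subseteq> V" by (auto simp: bad_def)
      ultimately show ?thesis using single that by blast
    qed
    have "d = e" if *: "d \<in> A" "e \<in> A" "c \<in> A" "src d = src c" "src e = src c" "src c \<noteq> v"
      "face c \<in> S" "face d \<notin> S" "face e \<notin> S" for d e c
    proof (rule ccontr)
      assume "d \<noteq> e"
      then have "card {d, e} = 2" by simp
      moreover have "{d, e} \<subseteq> out (src c)"
        using * by (auto simp: out_def)
      ultimately have "card (out (src c)) \<ge> 2"
        using card_mono[OF fin_out] by metis
      then have "src c \<in> bad" using * by (auto simp: bad_def)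
      then show False using v * by auto
    qed
    then show False
      using single_face_if_simple_boundary[OF S(1-3,5) v(1)] many by blast
  qed
  then show "t \<le> int (card (boundary S)) + 2" using t by linarith
qed

section \<open>Edge capacities and the bond condition\<close>

text \<open>The inner minimum never allows more bends than were given, except that one bend is
  always allowed. This is how a valid representation with positive flexibility stays valid.\<close>

lemma few_bends:
  fixes x a :: "'d \<Rightarrow> int"
  assumes "skew x" "out \<in> F" and a: "\<And>d. d \<in> A \<Longrightarrow> a d \<ge> 1"
    and angles: "\<And>v. v \<in> V \<Longrightarrow> (\<Sum>d | d \<in> A \<and> src d = v. a d) = 4"
    and rotation: "\<And>f. f \<in> F \<Longrightarrow>
      sum x (region {f}) + (\<Sum>d\<in>region {f}. 2 - a d) = (if f = out then -4 else 4)"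
  obtains y d0 where "skew y" "\<forall>f\<in>F. sum y (region {f}) = sum x (region {f})"
    and "d0 \<in> A" "face d0 = out"
    and "\<forall>d\<in>A. \<bar>y d\<bar> \<le> max 1 (min \<bar>x d\<bar> (if d = d0 \<or> d = opp d0 then 5 else 3))"
proof -
  have abs_opp: "\<bar>x (opp d)\<bar> = \<bar>x d\<bar>" if "d \<in> A" for d
    using assms(1) that by (simp add: skew_def)
  obtain d0 where d0: "d0 \<in> A" "face d0 = out"
    \<comment> \<open>Only edges with exactly one side on the outer face matter for the maximum. If
      there are none, any outer dart will do.\<close>
    and d0_max: "\<And>d. d \<in> boundary {out} \<Longrightarrow> d0 \<in> boundary {out} \<and> \<bar>x d\<bar> \<le> \<bar>x d0\<bar>"
  proof (cases "boundary {out} = {}")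
    case True
    then show ?thesis using assms(2) that by auto
  next
    case False
    then have "Max ((\<lambda>d. \<bar>x d\<bar>) ` boundary {out}) \<in> (\<lambda>d. \<bar>x d\<bar>) ` boundary {out}" by simp
    then obtain d0 where d0: "d0 \<in> boundary {out}" "Max ((\<lambda>d. \<bar>x d\<bar>) ` boundary {out}) = \<bar>x d0\<bar>"
      by auto
    moreover have "\<bar>x d\<bar> \<le> \<bar>x d0\<bar>" if "d \<in> boundary {out}" for d
      using that d0(2) by (metis (no_types, lifting) Max_ge finite_boundary finite_imageI imageI)
    ultimately show ?thesis using that[of d0] by (auto simp: boundary_def)
  qed
  define c where "c d = max 1 (min \<bar>x d\<bar> (if d = d0 \<or> d = opp d0 then 5 else 3))" for d
  have c_opp: "c (opp d) = c d" if "d \<in> A" for d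
  proof -
    have "opp d = d0 \<or> opp d = opp d0 \<longleftrightarrow> d = d0 \<or> d = opp d0"
      using that d0(1) opp_opp by metis
    then show ?thesis using abs_opp[OF that] by (simp add: c_def)
  qed
  have c_nonneg: "c d \<ge> 0" for d
    by (simp add: c_def)
  have "sum x (region S) \<le> sum c (boundary S)" if "bond S" for S
  proof (cases "\<forall>d\<in>boundary S. \<bar>x d\<bar> \<le> c d")
    case True
    then have "sum x (boundary S) \<le> sum c (boundary S)"
      by (intro sum_mono) (meson abs_le_D1)
    then show ?thesis using skew_sum_region[OF assms(1)] by simp
  next
    case False
    then obtain d1 where d1: "d1 \<in> boundary S" "\<bar>x d1\<bar> > c d1" by auto
    have S: "S \<subseteq> F" using that by (simp add: bond_def)
    have "finite S" using S finite_darts finite_subset by blast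
    have "sum x (region S) + (\<Sum>d\<in>region S. 2 - a d) = (\<Sum>f\<in>S. if f = out then -4 else 4)"
    proof -
      have "(\<Sum>f\<in>S. if f = out then -4 else 4) = (\<Sum>f\<in>S. sum x (region {f}) + (\<Sum>d\<in>region {f}. 2 - a d))"
        using S rotation by (intro sum.cong) auto
      then show ?thesis using S by (simp add: sum_region_faces sum.distrib)
    qed
    also have "\<dots> = (\<Sum>f\<in>S. 4 - 8 * of_bool (f = out))"
      by (intro sum.cong) auto
    also have "\<dots> = 4 * int (card S) - 8 * of_bool (out \<in> S)"
      using \<open>finite S\<close> by (simp add: sum_subtractf of_bool_def flip: sum_distrib_left)
    finally have x_eq: "sum x (region S) = 4 * int (card S) + sum a (region S)
        - 2 * int (card (region S)) - 8 * of_bool (out \<in> S)"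
      by (simp add: sum_subtractf)
    have c_ge: "sum c (boundary S) \<ge> int (card (boundary S)) + (\<Sum>d\<in>X. c d - 1)"
      if "X \<subseteq> boundary S" for X
    proof -
      have "(\<Sum>d\<in>X. c d - 1) \<le> (\<Sum>d\<in>boundary S. c d - 1)"
        using that by (intro sum_mono2) (auto simp: c_def)
      then show ?thesis by (simp add: sum_subtractf)
    qed
    \<comment> \<open>Since \<open>\<bar>x d1\<bar>\<close> exceeds \<open>c d1\<close>, the value
      of \<open>c d1\<close> is the cap 3 or 5 itself.\<close>
    have c1: "c d1 \<ge> 3" "d1 = opp d0 \<Longrightarrow> c d1 \<ge> 5"
      using d1(2) by (auto simp: c_def max_def min_def split: if_splits)
    have plus2: "sum c (boundary S) \<ge> int (card (boundary S)) + 2"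
      using c_ge[of "{d1}"] d1(1) c1(1) by simp
    \<comment> \<open>Only the bond around the outer face, with \<open>S\<close> on its inner side,
      may demand \<open>n + 4\<close>. If \<open>out\<close> lies in \<open>S\<close>, the term -8
      more than suffices; otherwise the bound \<open>n + 2\<close> applies.\<close>
    show ?thesis
    proof (cases "out \<notin> S \<and> (\<exists>g. F - S = {g})")
      case False
      then show ?thesis
        using x_eq plus2 bond_rotation_le[OF that a angles] by (auto split: if_splits)
    next
      case True
      then have "out \<in> F - S" using assms(2) by blast
      then have out: "F - S = {out}" using True by (metis singletonD)
      have "opp d1 \<in> boundary {out}"
        using d1(1) out opp_in[of d1] opp_opp[of d1] by (auto simp: boundary_def)
      then have "d0 \<in> boundary {out}" "\<bar>x d1\<bar> \<le> \<bar>x d0\<bar>"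
        using d0_max[of "opp d1"] d1(1) abs_opp by (auto simp: boundary_def)
      then have opp0: "opp d0 \<in> boundary S"
        using out by (auto simp: boundary_def opp_in opp_opp)
      have "sum c (boundary S) \<ge> int (card (boundary S)) + 4"
      proof (cases "d1 = opp d0")
        case True
        then show ?thesis using c_ge[of "{d1}"] d1(1) c1(2) by simp
      next
        case False
        \<comment> \<open>By its maximality, \<open>d0\<close> has at least as many bends as
          \<open>d1\<close>, hence at least 4. So \<open>d1\<close> and \<open>opp d0\<close> supply
          at least 2 and 3 units beyond 1 each.\<close>
        have "\<bar>x (opp d0)\<bar> \<ge> 4"
          using \<open>\<bar>x d1\<bar> \<le> \<bar>x d0\<bar>\<close> c1(1) d1(2) abs_opp[OF d0(1)] by linarith
        then have "c (opp d0) \<ge> 4" by (simp add: c_def)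
        then show ?thesis
          using c_ge[of "{d1, opp d0}"] d1(1) opp0 c1(1) False by simp
      qed
      then show ?thesis
        using x_eq True bond_rotation_le(1)[OF that a angles] by simp
    qed
  qed
  then obtain y where "skew y" "\<forall>f\<in>F. sum y (region {f}) = sum x (region {f})"
    and "\<forall>d\<in>A. \<bar>y d\<bar> \<le> c d"
    using skew_with_capacities[of c x] c_nonneg c_opp assms(1) by blast
  then show thesis
    using that[of y d0] d0 unfolding c_def by blast
qed

end

section \<open>From planar embeddings to combinatorial maps\<close>

lemma connected_closed_set:
  assumes "connected H" "U \<subseteq> verts H" "U \<noteq> {}"
    and closed: "\<And>e. e \<in> arcs H \<Longrightarrow> tail H e \<in> U \<longleftrightarrow> head H e \<in> U"
  shows "U = verts H"
proof
  obtain u where u: "u \<in> U" using assms(3) by auto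
  show "verts H \<subseteq> U"
  proof
    fix v assume "v \<in> verts H"
    then have "(u, v) \<in> rtrancl_on (verts H) (parcs (mk_symmetric H))"
      using assms(1,2) u by (auto simp: connected_def strongly_connected_def reachable_def)
    then show "v \<in> U"
    proof (induction rule: rtrancl_on_induct)
      case (step x y)
      then show ?case using closed by (auto simp: parcs_mk_symmetric)
    qed (use u in simp)
  qed
qed (use assms in simp)

lemma orbit_face_succ:
  assumes "rotation E permutes A" "finite A" "\<And>d. d \<in> A \<Longrightarrow> prod.swap d \<in> A" "d \<in> A"
  shows "d \<in> orbit (face_succ E) d" and "orbit (face_succ E) d \<subseteq> A"
proof -
  \<comment> \<open>Outside \<open>A\<close>, \<open>prod.swap\<close> still moves pairs. Making the
    map the identity there yields a permutation with the same orbits on \<open>A\<close>.\<close>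
  define g where "g d = (if d \<in> A then face_succ E d else d)" for d
  have "bij_betw prod.swap A A"
    using assms(3) by (intro bij_betw_byWitness[of _ prod.swap]) auto
  then have "bij_betw (rotation E \<circ> prod.swap) A A"
    using permutes_imp_bij[OF assms(1)] by (rule bij_betw_trans)
  then have "bij_betw g A A"
    by (rule bij_betw_cong[THEN iffD1, rotated]) (simp add: g_def face_succ_def)
  then have "g permutes A"
    by (intro bij_imp_permutes) (auto simp: g_def)
  moreover have "orbit g d = orbit (face_succ E) d"
    using assms(4) \<open>bij_betw g A A\<close>
    by (intro orbit_cong0[of d A]) (auto simp: g_def dest: bij_betwE)
  ultimately show "d \<in> orbit (face_succ E) d" "orbit (face_succ E) d \<subseteq> A"
    using permutation_self_in_orbit[of g d] permutes_orbit_subset[of g A d] assms(2,4)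
    by (auto simp: permutation_permutes)
qed

lemma embedding_biconnected_map:
  assumes "pair_graph G" "biconnected G" "planar_embedding G E"
  shows "biconnected_map (parcs G) prod.swap (rotation E) fst (orbit (face_succ E))"
    and "fst ` parcs G = pverts G"
proof -
  interpret pair_graph G by fact
  let ?f = "face_succ E"
  have E: "connected (with_proj G)" "rotation E permutes parcs G"
    "\<And>v. v \<in> pverts G \<Longrightarrow> darts_at G v \<noteq> {} \<Longrightarrow> cyclic_on (rotation E) (darts_at G v)"
    "outer_face E \<in> faces G E"
    using assms(3) by (auto simp: planar_embedding_def)
  have swap: "prod.swap d \<in> parcs G" if "d \<in> parcs G" for d
    using that pair_sym_arcs by (cases d) (auto simp: symmetric_def sym_def)
  have verts: "fst d \<in> pverts G" "snd d \<in> pverts G" if "d \<in> parcs G" for d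
    using that arc_fst_in_verts arc_snd_in_verts by auto
  have self: "d \<in> orbit ?f d" and sub: "orbit ?f d \<subseteq> parcs G" if "d \<in> parcs G" for d
    using orbit_face_succ[OF E(2) pair_finite_arcs swap that] by auto
  have cyc: "cyclic_on (rotation E) (darts_at G (fst d))" if "d \<in> parcs G" for d
    using that verts by (intro E(3)) auto
  \<comment> \<open>There are no isolated vertices: the outer face provides a dart, and the ends of
    darts are closed under adjacency.\<close>
  show V: "fst ` parcs G = pverts G"
  proof -
    have "snd d \<in> fst ` parcs G" if "d \<in> parcs G" for d
      using imageI[OF swap[OF that], of fst] by simp
    then have "fst d \<in> fst ` parcs G \<longleftrightarrow> snd d \<in> fst ` parcs G" if "d \<in> parcs G" for d
      using that by simp
    moreover have "parcs G \<noteq> {}" using E(4) by (auto simp: faces_def)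
    ultimately show ?thesis
      using connected_closed_set[OF E(1), of "fst ` parcs G"] verts by (simp add: image_subset_iff)
  qed
  show "biconnected_map (parcs G) prod.swap (rotation E) fst (orbit ?f)"
  proof
    show "finite (parcs G)" by (rule pair_finite_arcs)
    show "rotation E d \<in> parcs G" if "d \<in> parcs G" for d
      using that E(2) by (simp add: permutes_in_image)
    show "fst (rotation E d) = fst d" if "d \<in> parcs G" for d
      using cyclic_on_inI[OF cyc[OF that], of d] that by auto
    show "orbit ?f (rotation E (prod.swap d)) = orbit ?f d" if "d \<in> parcs G" for d
      using self_in_orbit_step[OF self[OF that]] by (simp add: face_succ_def)
    show "d' \<in> X" if X: "X \<subseteq> parcs G" "d \<in> X" "\<And>e. e \<in> X \<Longrightarrow> rotation E e \<in> X"
      "d' \<in> parcs G" "fst d' = fst d" for X d d'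
    proof -
      have "d' \<in> orbit (rotation E) d"
        using orbit_cyclic_eq3[OF cyc, of d d] X by auto
      then show ?thesis by induction (use X in auto)
    qed
    show "d' \<in> X" if X: "X \<subseteq> parcs G" "d \<in> X" "\<And>e. e \<in> X \<Longrightarrow> rotation E (prod.swap e) \<in> X"
      "d' \<in> parcs G" "orbit ?f d' = orbit ?f d" for X d d'
    proof -
      have "d' \<in> orbit ?f d" using self X by metis
      then show ?thesis by induction (use X in \<open>auto simp: face_succ_def\<close>)
    qed
    show "fst (prod.swap d) \<noteq> fst d" if "d \<in> parcs G" for d
      using pair_no_loops[OF that] by simp
    show "U = fst ` parcs G" if U: "U \<subseteq> fst ` parcs G" "U \<noteq> {}"
      "\<And>d. d \<in> parcs G \<Longrightarrow> fst d \<in> U \<Longrightarrow> fst (prod.swap d) \<in> U" for U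
    proof -
      have "fst d \<in> U \<longleftrightarrow> snd d \<in> U" if "d \<in> parcs G" for d
        using U(3)[OF that] U(3)[OF swap[OF that]] by auto
      then show ?thesis
        using connected_closed_set[OF E(1), of U] U(1,2) V by simp
    qed
    show "U = fst ` parcs G - {v}" if U: "v \<in> fst ` parcs G" "U \<subseteq> fst ` parcs G - {v}" "U \<noteq> {}"
      "\<And>d. d \<in> parcs G \<Longrightarrow> fst d \<in> U \<Longrightarrow> fst (prod.swap d) \<noteq> v \<Longrightarrow> fst (prod.swap d) \<in> U" for v U
    proof -
      have "connected (pre_digraph.del_vert (with_proj G) v)"
        using assms(2) U(1) V by (simp add: biconnected_def)
      moreover have "fst d \<in> U \<longleftrightarrow> snd d \<in> U" if "d \<in> parcs G" "fst d \<noteq> v" "snd d \<noteq> v" for d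
        using U(4)[OF that(1)] U(4)[OF swap[OF that(1)]] that by auto
      ultimately show ?thesis
        using connected_closed_set[of "pre_digraph.del_vert (with_proj G) v" U] U(2,3) V
        by (simp add: del_vert_simps)
    qed
  qed (auto intro: swap)
qed

section \<open>Rerouting the rotations of the given representation\<close>

theorem theorem2:
  fixes G :: "'v pair_pre_digraph"
    and flex :: "'v set \<Rightarrow> enat"
    and R :: "'v orthogonal_rep"
  assumes "pair_graph G"
    and "biconnected G"
    and "four_planar G"
    and "positive_flexibility G flex"
    and "valid_representation G flex R"
  shows "\<exists>R' :: 'v orthogonal_rep.
           valid_representation G flex R' \<and>
           embedding R' = embedding R \<and>
           (\<forall>d \<in> parcs G. vert_rot R' d = vert_rot R d) \<and>
           (\<exists>e\<^sub>0 \<in> edge_of ` outer_face (embedding R). \<forall>d \<in> parcs G.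
              bends R' d \<le> (if edge_of d = e\<^sub>0 then 5 else 3))"
proof -
  let ?E = "embedding R" and ?x = "edge_rot R"
  let ?face = "orbit (face_succ ?E)"
  have rep: "orthogonal_representation G R"
    and flex: "\<And>d. d \<in> parcs G \<Longrightarrow> enat (bends R d) \<le> flex (edge_of d)"
    using assms(5) by (auto simp: valid_representation_def)
  then have planar: "planar_embedding G ?E"
    by (simp add: orthogonal_representation_def)
  interpret biconnected_map "parcs G" prod.swap "rotation ?E" fst ?face
    by (rule embedding_biconnected_map) fact+
  have V: "fst ` parcs G = pverts G"
    by (rule embedding_biconnected_map) fact+
  have perm: "rotation ?E permutes parcs G" and outer: "outer_face ?E \<in> F"
    using planar by (auto simp: planar_embedding_def faces_def)
  have self: "d \<in> ?face d" and sub: "?face d \<subseteq> parcs G" if "d \<in> parcs G" for d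
    using orbit_face_succ[OF perm finite_darts opp_in that] by auto
  \<comment> \<open>Faces are labelled by their own orbits, so the darts labelled \<open>f\<close>
    are the elements of \<open>f\<close>, and the two kinds of face sums agree.\<close>
  have region: "region {f} = f" if "f \<in> F" for f
  proof -
    obtain d where d: "d \<in> parcs G" "f = ?face d" using \<open>f \<in> F\<close> by blast
    then have "cyclic_on (face_succ ?E) f"
      using self by (intro cyclic_on_singleI[of d]) auto
    then have face: "?face e = f" if "e \<in> f" for e
      using that by (rule orbit_cyclic_eq3)
    show ?thesis
    proof
      show "region {f} \<subseteq> f"
        using self unfolding region_def by blast
      show "f \<subseteq> region {f}"
        using face sub[OF d(1)] d(2) unfolding region_def by blast
    qed
  qed
  \<comment> \<open>The angle in units of 90 degrees: rotations 1, 0, -1 become 1, 2, 3, and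
    condition (III) becomes the total 4 at every vertex.\<close>
  let ?a = "\<lambda>d. 2 - vert_rot R d"
  have "?x d = - ?x (prod.swap d)" if "d \<in> parcs G" for d
    using rep that unfolding orthogonal_representation_def by blast
  then have "?x (prod.swap d) = - ?x d" if "d \<in> parcs G" for d
    using that by (metis minus_minus)
  then have skew: "skew ?x" by (simp add: skew_def)
  have angle_pos: "?a d \<ge> 1" if "d \<in> parcs G" for d
  proof -
    have "vert_rot R d \<in> {-1, 0, 1}"
      using rep that unfolding orthogonal_representation_def by blast
    then show ?thesis by auto
  qed
  have angles: "(\<Sum>d | d \<in> parcs G \<and> fst d = v. ?a d) = 4" if "v \<in> V" for v
  proof -
    have "(\<Sum>d\<in>darts_at G v. vert_rot R d) = 2 * (int (degree G v) - 2)"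
      using rep that V unfolding orthogonal_representation_def by blast
    then show ?thesis
      by (simp add: sum_subtractf out_arcs_def out_degree_def)
  qed
  have rot: "sum ?x (region {f}) + (\<Sum>d\<in>region {f}. 2 - ?a d)
      = (if f = outer_face ?E then -4 else 4)" if "f \<in> F" for f
  proof -
    have "sum ?x f + sum (vert_rot R) f = (if f = outer_face ?E then -4 else 4)"
      using rep that unfolding orthogonal_representation_def faces_def by blast
    then show ?thesis using region[OF that] by simp
  qed
  obtain y d0 where
    y: "skew y" "\<forall>f\<in>F. sum y (region {f}) = sum ?x (region {f})"
    and d0: "d0 \<in> parcs G" "?face d0 = outer_face ?E"
    and le: "\<forall>d\<in>parcs G.
      \<bar>y d\<bar> \<le> max 1 (min \<bar>?x d\<bar> (if d = d0 \<or> d = prod.swap d0 then 5 else 3))"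
    by (rule few_bends[OF skew outer angle_pos angles rot])
  define R' where "R' = R\<lparr>edge_rot := y\<rparr>"
  have "orthogonal_representation G R'"
    unfolding orthogonal_representation_def
  proof (intro conjI ballI)
    fix d assume "d \<in> parcs G"
    then show "edge_rot R' d = - edge_rot R' (prod.swap d)"
      using y(1) by (simp add: skew_def R'_def)
  next
    fix f assume "f \<in> faces G (embedding R')"
    then have "f \<in> F" by (simp add: faces_def R'_def)
    then show "sum (edge_rot R') f + sum (vert_rot R') f =
        (if f = outer_face (embedding R') then - 4 else 4)"
      using rot[of f] bspec[OF y(2), of f] region[of f] by (simp add: R'_def)
  qed (use rep in \<open>simp_all add: orthogonal_representation_def R'_def\<close>)
  \<comment> \<open>Either at most one bend remains, allowed by positive flexibility, or at most as
    many as in \<open>R\<close>.\<close>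
  moreover have flex': "enat (bends R' d) \<le> flex (edge_of d)" if "d \<in> parcs G" for d
  proof -
    have "\<bar>y d\<bar> \<le> 1 \<or> \<bar>y d\<bar> \<le> \<bar>?x d\<bar>"
      using bspec[OF le that] by (auto simp: le_max_iff_disj)
    then have "bends R' d \<le> 1 \<or> bends R' d \<le> bends R d"
      by (auto simp: bends_def R'_def nat_le_iff)
    moreover have "enat 1 \<le> flex (edge_of d)"
      using assms(4) that by (auto simp: positive_flexibility_def edges_def one_enat_def)
    ultimately show ?thesis
      using flex[OF that] by (meson enat_ord_simps(1) order_trans)
  qed
  moreover have "bends R' d \<le> (if edge_of d = edge_of d0 then 5 else 3)" if "d \<in> parcs G" for d
  proof -
    have "edge_of (prod.swap d0) = edge_of d0" by (cases d0) auto
    then show ?thesis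
      using bspec[OF le that] by (auto simp: bends_def R'_def split: if_splits)
  qed
  moreover have "d0 \<in> outer_face ?E"
    using self[OF d0(1)] d0(2) by simp
  ultimately show ?thesis
  proof (intro exI[of _ R'] conjI bexI[of _ "edge_of d0"] ballI)
    show "valid_representation G flex R'"
      using \<open>orthogonal_representation G R'\<close> flex'
      unfolding valid_representation_def by blast
  qed (simp_all add: R'_def)
qed

end
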